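(* Let $G$ be a graph on $n$ vertices with $\sigma_2(G) \ge 2\tilde{\alpha}(G) - 1$. Then $G$ is Hamiltonian, unless $G$ is isomorphic to a subgraph of $K_k \oplus_1 K_{n+1-k}$ for some positive integer $k \le \frac{n+2}{4}$.
   Context: All graphs are finite and simple. For a graph $G$, $\sigma_2(G) = \min\{d(x)+d(y) : x,y \text{ distinct, nonadjacent vertices of } G\}$, where $d$ denotes degree. For positive integers $s,t$, an $(s,t)$-bipartite-hole of $G$ is a pair of disjoint vertex sets $S,T$ with $|S|=s$, $|T|=t$ and no edge of $G$ between $S$ and $T$. The bipartite-hole-number $\tilde{\alpha}(G)$ is the minimum integer $k$ such that there exist positive integers $s,t$ with $s+t=k+1$ for which $G$ contains no $(s,t)$-bipartite-hole. For complete graphs $K_a, K_b$, $K_a \oplus_1 K_b$ denotes the graph obtained from disjoint copies of $K_a$ and $K_b$ by identifying one vertex of $K_a$ with one vertex of $K_b$. A graph is Hamiltonian if it contains a cycle through all of its vertices. *)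

theory Defs
  imports Complex_Main "HOL-Library.Extended_Nat"
begin

record 'a graph =
  verts :: "'a set"
  edges :: "'a set set"

definition simple_graph :: "'a graph \<Rightarrow> bool" where
  "simple_graph G \<longleftrightarrow> finite (verts G) \<and> (\<forall>e\<in>edges G. e \<subseteq> verts G \<and> card e = 2)"

definition adjacent :: "'a graph \<Rightarrow> 'a \<Rightarrow> 'a \<Rightarrow> bool" where
  "adjacent G x y \<longleftrightarrow> {x, y} \<in> edges G"

definition degree :: "'a graph \<Rightarrow> 'a \<Rightarrow> nat" where
  "degree G x = card {y \<in> verts G. adjacent G x y}"

text \<open>The value lies in \<^typ>\<open>enat\<close> because the minimum over an empty set of pairs
  (that is, for a complete graph) is taken to be infinite.\<close>

definition sigma2 :: "'a graph \<Rightarrow> enat" where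
  "sigma2 G = Inf {enat (degree G x + degree G y) | x y.
     x \<in> verts G \<and> y \<in> verts G \<and> x \<noteq> y \<and> \<not> adjacent G x y}"

definition bipartite_hole :: "'a graph \<Rightarrow> nat \<Rightarrow> nat \<Rightarrow> 'a set \<Rightarrow> 'a set \<Rightarrow> bool" where
  "bipartite_hole G s t S T \<longleftrightarrow>
     S \<subseteq> verts G \<and> T \<subseteq> verts G \<and> S \<inter> T = {} \<and> card S = s \<and> card T = t \<and>
     (\<forall>x\<in>S. \<forall>y\<in>T. \<not> adjacent G x y)"

text \<open>For a finite graph the minimum exists, since there is no hole with
  \<open>s + t > card (verts G)\<close>; it is at least 1.\<close>

definition bipartite_hole_number :: "'a graph \<Rightarrow> nat" where
  "bipartite_hole_number G =
     (LEAST k. \<exists>s t. s > 0 \<and> t > 0 \<and> s + t = k + 1 \<and> \<not> (\<exists>S T. bipartite_hole G s t S T))"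

definition is_cycle :: "'a graph \<Rightarrow> 'a list \<Rightarrow> bool" where
  "is_cycle G vs \<longleftrightarrow> length vs \<ge> 3 \<and> distinct vs \<and> set vs \<subseteq> verts G \<and>
     (\<forall>i<length vs. adjacent G (vs ! i) (vs ! ((i + 1) mod length vs)))"

definition hamiltonian :: "'a graph \<Rightarrow> bool" where
  "hamiltonian G \<longleftrightarrow> (\<exists>vs. is_cycle G vs \<and> set vs = verts G)"

definition subgraph :: "'a graph \<Rightarrow> 'a graph \<Rightarrow> bool" where
  "subgraph H G \<longleftrightarrow> simple_graph H \<and> verts H \<subseteq> verts G \<and> edges H \<subseteq> edges G"

definition isomorphic :: "'a graph \<Rightarrow> 'b graph \<Rightarrow> bool" where
  "isomorphic G H \<longleftrightarrow> (\<exists>f. bij_betw f (verts G) (verts H) \<and>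
     (\<forall>x\<in>verts G. \<forall>y\<in>verts G. adjacent G x y \<longleftrightarrow> adjacent H (f x) (f y)))"

definition isomorphic_to_subgraph :: "'a graph \<Rightarrow> 'b graph \<Rightarrow> bool" where
  "isomorphic_to_subgraph G H \<longleftrightarrow> (\<exists>H'. subgraph H' H \<and> isomorphic G H')"

definition complete_graph :: "'a set \<Rightarrow> 'a graph" where
  "complete_graph A = \<lparr>verts = A, edges = {e. e \<subseteq> A \<and> card e = 2}\<rparr>"

text \<open>The graph obtained from disjoint complete graphs on \<open>a\<close> and \<open>b\<close> vertices by identifying
  a vertex of one with a vertex of the other, for positive \<open>a\<close> and \<open>b\<close>. The two cliques are
  placed on intervals of natural numbers that overlap in the single vertex \<open>a - 1\<close>.
  For \<open>a = 1\<close> this is the complete graph on \<open>b\<close> vertices, which contains every graph on \<open>b\<close>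
  vertices; only \<open>a, b \<ge> 2\<close> gives a restrictive exceptional family.\<close>

definition complete_one_sum :: "nat \<Rightarrow> nat \<Rightarrow> nat graph" where
  "complete_one_sum a b =
    (let A = complete_graph {0..<a}; B = complete_graph {a - 1..<a + b - 1}
     in \<lparr>verts = verts A \<union> verts B, edges = edges A \<union> edges B\<rparr>)"

end

theory Submission
  imports Defs
begin

text \<open>Choose \<open>s + t = k + 1\<close>, where \<open>k\<close> is the bipartite-hole-number, such that there is no
  \<open>(s, t)\<close>-hole, and pass to an edge-maximal non-Hamiltonian supergraph. There the vertices of
  degree less than \<open>k\<close> are pairwise adjacent by the Ore condition, and the vertices of degree at
  least \<open>k\<close> are pairwise adjacent by the rotation argument of McDiarmid and Yolov, applied to a
  Hamiltonian path between two nonadjacent ones. Two cliques covering a non-Hamiltonian graph are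
  not joined by two disjoint edges, so some cut vertex separates them up to that vertex. The size
  bound follows from the Ore condition for two vertices on different sides of the cut, since the
  sides would otherwise contain an \<open>(s, t)\<close>-hole.\<close>

section \<open>Hamiltonian cycles and paths as vertex lists\<close>

lemma adjacent_sym: "adjacent G x y \<longleftrightarrow> adjacent G y x"
  by (simp add: adjacent_def insert_commute)

text \<open>Splits the cyclic index condition of \<open>is_cycle\<close> into a path condition and
  one closing edge, a form that is easy to check for lists built by appending and reversing.\<close>

lemma hamiltonianI:
  assumes "distinct xs" "set xs = verts G" "length xs \<ge> 3"
    and "successively (adjacent G) xs" "adjacent G (last xs) (hd xs)"
  shows "hamiltonian G"
proof -
  have "adjacent G (xs ! i) (xs ! ((i + 1) mod length xs))" if "i < length xs" for i
  proof (cases "Suc i < length xs")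
    case True
    then show ?thesis using successively_nth[OF assms(4)] by simp
  next
    case False
    then have "i = length xs - 1" "xs \<noteq> []" using that by auto
    then show ?thesis using assms(5) that by (simp add: last_conv_nth hd_conv_nth)
  qed
  then show ?thesis using assms unfolding hamiltonian_def is_cycle_def by auto
qed

text \<open>Since \<open>G\<close> itself is not Hamiltonian, the cycle in the enlarged graph uses
  the new edge. Removing that edge from the cycle leaves a Hamiltonian path of \<open>G\<close>
  whose ends are \<open>x\<close> and \<open>y\<close>.\<close>

lemma hamiltonian_path_of_insert_edge:
  assumes "hamiltonian (G\<lparr>edges := insert {x, y} (edges G)\<rparr>)" "\<not> hamiltonian G"
  obtains p where "distinct p" "set p = verts G" "successively (adjacent G) p"
    "{hd p, last p} = {x, y}"
proof -
  let ?G' = "G\<lparr>edges := insert {x, y} (edges G)\<rparr>"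
  have adj': "adjacent ?G' u v \<longleftrightarrow> {u, v} = {x, y} \<or> adjacent G u v" for u v
    by (simp add: adjacent_def)
  obtain vs where vs: "is_cycle ?G' vs" "set vs = verts G"
    using assms(1) by (auto simp: hamiltonian_def)
  let ?n = "length vs"
  have n: "?n \<ge> 3" and dist: "distinct vs"
    and adjvs: "\<And>i. i < ?n \<Longrightarrow> adjacent ?G' (vs ! i) (vs ! ((i + 1) mod ?n))"
    using vs by (auto simp: is_cycle_def)
  have "\<exists>i<?n. \<not> adjacent G (vs ! i) (vs ! ((i + 1) mod ?n))"
  proof (rule ccontr)
    assume "\<not> ?thesis"
    then have "is_cycle G vs" using n dist vs by (auto simp: is_cycle_def)
    then show False using assms(2) vs by (auto simp: hamiltonian_def)
  qed
  then obtain i where i: "i < ?n" "{vs ! i, vs ! ((i + 1) mod ?n)} = {x, y}"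
    using adjvs adj' by blast
  \<comment> \<open>The rotation moves the edge missing from \<open>G\<close> to the closing
    position, between \<open>last p\<close> and \<open>hd p\<close>.\<close>
  define p where "p = rotate (i + 1) vs"
  have len: "length p = ?n" and pne: "p \<noteq> []" using n by (auto simp: p_def)
  have pd: "distinct p" using dist by (simp add: p_def)
  have nth: "p ! j = vs ! ((i + 1 + j) mod ?n)" if "j < ?n" for j
    by (simp only: p_def nth_rotate[OF that])
  have hd: "hd p = vs ! ((i + 1) mod ?n)"
    using nth[of 0] n pne len by (cases "vs = []") (simp_all add: hd_conv_nth)
  have "i + 1 + (?n - 1) = i + ?n" using n by simp
  then have "(i + 1 + (?n - 1)) mod ?n = i" using i(1) by (simp only: mod_add_self2 mod_less)
  then have last: "last p = vs ! i"
    using nth[of "?n - 1"] n len pne by (subst last_conv_nth) auto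
  have ends: "{hd p, last p} = {x, y}" using i hd last by auto
  have "adjacent G (p ! j) (p ! Suc j)" if j: "Suc j < length p" for j
  proof -
    have "p ! Suc j = vs ! (((i + 1 + j) mod ?n + 1) mod ?n)"
      using nth[of "Suc j"] j len by (simp add: mod_simps)
    moreover have "(i + 1 + j) mod ?n < ?n" using n by (intro mod_less_divisor) linarith
    ultimately have "adjacent ?G' (p ! j) (p ! Suc j)"
      using adjvs[of "(i + 1 + j) mod ?n"] nth[of j] j len by simp
    \<comment> \<open>As the cycle has at least three vertices, the two ends of \<open>p\<close> are
      not consecutive in \<open>p\<close>, so no step of the path is the new edge.\<close>
    moreover have "{p ! j, p ! Suc j} \<noteq> {p ! 0, p ! (length p - 1)}"
    proof -
      have bounds: "0 < length p" "j < length p" "length p - 1 < length p" using j by linarith+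
      have "p ! j \<noteq> p ! (length p - 1)"
        using j nth_eq_iff_index_eq[OF pd bounds(2,3)] by linarith
      moreover have "\<not> (p ! j = p ! 0 \<and> p ! Suc j = p ! (length p - 1))"
        using j n len nth_eq_iff_index_eq[OF pd bounds(2,1)] nth_eq_iff_index_eq[OF pd j bounds(3)]
        by linarith
      ultimately show ?thesis unfolding doubleton_eq_iff by blast
    qed
    ultimately show ?thesis using adj' ends pne by (simp add: hd_conv_nth last_conv_nth)
  qed
  then have "successively (adjacent G) p" by (simp add: successively_conv_nth)
  moreover have "set p = verts G" using vs(2) by (simp add: p_def)
  ultimately show thesis using that pd ends by blast
qed

section \<open>Exchanges on a Hamiltonian path and the rotation argument\<close>

text \<open>The cycle traverses \<open>P\<close>, jumps to \<open>R\<close>, traverses it, then runs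
  through \<open>Q\<close> backwards and returns from \<open>hd Q\<close> to
  \<open>hd P\<close>.\<close>

lemma hamiltonian_parallel_exchange:
  assumes "distinct (P @ Q @ R)" "set (P @ Q @ R) = verts G"
    and "successively (adjacent G) (P @ Q @ R)" "P \<noteq> []" "Q \<noteq> []" "R \<noteq> []"
    and "adjacent G (hd P) (hd Q)" "adjacent G (last R) (last Q)" "adjacent G (last P) (hd R)"
  shows "hamiltonian G"
proof (rule hamiltonianI[of "P @ R @ rev Q"])
  show "length (P @ R @ rev Q) \<ge> 3" using assms(4-6) by (cases P; cases Q; cases R) auto
qed (use assms in \<open>auto simp: successively_append_iff hd_rev last_rev adjacent_sym\<close>)

text \<open>The cycle traverses \<open>R\<close>, then \<open>P\<close> backwards from
  \<open>last P\<close>, then \<open>Q\<close> backwards from \<open>last Q\<close>, and returns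
  from \<open>hd Q\<close> to \<open>hd R\<close>.\<close>

lemma hamiltonian_crossing_exchange:
  assumes "distinct (P @ Q @ R)" "set (P @ Q @ R) = verts G"
    and "successively (adjacent G) (P @ Q @ R)" "P \<noteq> []" "Q \<noteq> []" "R \<noteq> []"
    and "adjacent G (hd P) (last Q)" "adjacent G (last R) (last P)" "adjacent G (hd Q) (hd R)"
  shows "hamiltonian G"
proof (rule hamiltonianI[of "R @ rev P @ rev Q"])
  show "length (R @ rev P @ rev Q) \<ge> 3" using assms(4-6) by (cases P; cases Q; cases R) auto
qed (use assms in \<open>auto simp: successively_append_iff hd_rev last_rev adjacent_sym\<close>)

lemma split_list_two:
  assumes "0 < a" "a < b" "b < length p"
  obtains P Q R where "p = P @ Q @ R" "P \<noteq> []" "Q \<noteq> []" "R \<noteq> []"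
    "hd P = p ! 0" "last P = p ! (a - 1)" "hd Q = p ! a" "last Q = p ! (b - 1)"
    "hd R = p ! b" "last R = p ! (length p - 1)"
proof (rule that[of "take a p" "drop a (take b p)" "drop b p"])
  show "p = take a p @ drop a (take b p) @ drop b p"
    using assms by (metis append_assoc append_take_drop_id le_add_diff_inverse less_imp_le min.absorb1 take_take)
  have "p \<noteq> []" "take a p \<noteq> []" using assms by auto
  then show "hd (take a p) = p ! 0" "last (take a p) = p ! (a - 1)"
    using assms by (simp_all add: hd_conv_nth last_conv_nth)
qed (use assms in \<open>auto simp: hd_conv_nth last_conv_nth\<close>)

text \<open>Subsets of the two sides of a hole again form a hole, so lower bounds on the sizes
  suffice.\<close>

lemma bipartite_hole_shrink:
  assumes "S \<subseteq> verts G" "T \<subseteq> verts G" "S \<inter> T = {}" "s \<le> card S" "t \<le> card T"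
    and "\<And>x y. x \<in> S \<Longrightarrow> y \<in> T \<Longrightarrow> \<not> adjacent G x y"
  shows "\<exists>S T. bipartite_hole G s t S T"
proof -
  obtain S' where "S' \<subseteq> S" "card S' = s" using obtain_subset_with_card_n[OF assms(4)] by blast
  moreover obtain T' where "T' \<subseteq> T" "card T' = t"
    using obtain_subset_with_card_n[OF assms(5)] by blast
  ultimately have "bipartite_hole G s t S' T'"
    using assms unfolding bipartite_hole_def by blast
  then show ?thesis by blast
qed

lemma degree_eq_card_indices:
  assumes "distinct p" "set p = verts G"
  shows "degree G x = card {i. i < length p \<and> adjacent G x (p ! i)}"
proof -
  have "{y \<in> verts G. adjacent G x y} = (!) p ` {i. i < length p \<and> adjacent G x (p ! i)}"
    unfolding assms(2)[symmetric] by (force simp: in_set_conv_nth)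
  moreover have "inj_on ((!) p) {i. i < length p \<and> adjacent G x (p ! i)}"
    using assms(1) by (auto simp: inj_on_def nth_eq_iff_index_eq)
  ultimately show ?thesis by (simp add: degree_def card_image)
qed

text \<open>If \<open>G\<close> is not Hamiltonian, the two exchanges forbid edges between vertices
  next to neighbours of the first vertex and vertices next to neighbours of the last one. With this
  many neighbours at both ends, the forbidden pairs contain an \<open>(s, t)\<close>-hole.\<close>

lemma hamiltonian_of_path_large_end_degrees:
  assumes p: "distinct p" "set p = verts G" "successively (adjacent G) p" "p \<noteq> []"
    and nadj: "\<not> adjacent G (hd p) (last p)"
    and irr: "\<And>x. \<not> adjacent G x x"
    and deg: "s + t \<le> degree G (hd p) + 1" "s + t \<le> degree G (last p) + 1"
    and st: "s > 0" "t > 0"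
    and nohole: "\<not> (\<exists>S T. bipartite_hole G s t S T)"
  shows "hamiltonian G"
proof (rule ccontr)
  assume nham: "\<not> hamiltonian G"
  let ?n = "length p"
  define A where "A = {i. i < ?n \<and> adjacent G (hd p) (p ! i)}"
  define B where "B = {i. i < ?n \<and> adjacent G (last p) (p ! i)}"
  have fin: "finite A" "finite B" by (auto simp: A_def B_def)
  have cA: "s + t \<le> card A + 1" and cB: "s + t \<le> card B + 1"
    using deg by (simp_all add: A_def B_def degree_eq_card_indices[OF p(1,2)])
  have Apos: "0 < i \<and> Suc i < ?n" if "i \<in> A" for i
  proof -
    have "i \<noteq> 0" using that irr[of "p ! 0"] p(4) by (intro notI) (simp add: A_def hd_conv_nth)
    moreover have "i \<noteq> ?n - 1" using that nadj p(4) by (auto simp: A_def last_conv_nth)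
    ultimately show ?thesis using that by (auto simp: A_def)
  qed
  have Bpos: "Suc j < ?n" if "j \<in> B" for j
  proof -
    have "j \<noteq> ?n - 1" using that irr[of "p ! (?n - 1)"] p(4) by (auto simp: B_def last_conv_nth)
    then show ?thesis using that by (auto simp: B_def)
  qed
  \<comment> \<open>Here \<open>p\<close> is cut into the indices below \<open>i\<close>, those from
    \<open>i\<close> to \<open>j\<close>, and those beyond \<open>j\<close>.\<close>
  have parallel: "\<not> adjacent G (p ! (i - 1)) (p ! Suc j)" if "i \<in> A" "j \<in> B" "i \<le> j" for i j
  proof
    assume a: "adjacent G (p ! (i - 1)) (p ! Suc j)"
    have "0 < i" "i < Suc j" "Suc j < ?n" using Apos Bpos that by auto
    then obtain P Q R where "p = P @ Q @ R" "P \<noteq> []" "Q \<noteq> []" "R \<noteq> []"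
      "hd P = p ! 0" "last P = p ! (i - 1)" "hd Q = p ! i" "last Q = p ! (Suc j - 1)"
      "hd R = p ! Suc j" "last R = p ! (?n - 1)"
      by (rule split_list_two)
    moreover have "adjacent G (p ! 0) (p ! i)" "adjacent G (p ! (?n - 1)) (p ! j)"
      using that p(4) by (auto simp: A_def B_def hd_conv_nth last_conv_nth)
    ultimately show False
      using hamiltonian_parallel_exchange[of P Q R G] p a nham by simp
  qed
  \<comment> \<open>Here \<open>p\<close> is cut after \<open>j\<close> and after \<open>i\<close>,
    so the middle piece runs from \<open>Suc j\<close> to \<open>i\<close>.\<close>
  have crossing: "\<not> adjacent G (p ! Suc j) (p ! Suc i)" if "i \<in> A" "j \<in> B" "j < i" for i j
  proof
    assume a: "adjacent G (p ! Suc j) (p ! Suc i)"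
    have "0 < Suc j" "Suc j < Suc i" "Suc i < ?n" using Apos that by auto
    then obtain P Q R where "p = P @ Q @ R" "P \<noteq> []" "Q \<noteq> []" "R \<noteq> []"
      "hd P = p ! 0" "last P = p ! (Suc j - 1)" "hd Q = p ! Suc j" "last Q = p ! (Suc i - 1)"
      "hd R = p ! Suc i" "last R = p ! (?n - 1)"
      by (rule split_list_two)
    moreover have "adjacent G (p ! 0) (p ! i)" "adjacent G (p ! (?n - 1)) (p ! j)"
      using that p(4) by (auto simp: A_def B_def hd_conv_nth last_conv_nth)
    ultimately show False
      using hamiltonian_crossing_exchange[of P Q R G] p a nham by simp
  qed
  have no_index_hole: False
    if "S \<subseteq> {..<?n}" "T \<subseteq> {..<?n}" "S \<inter> T = {}" "s \<le> card S" "t \<le> card T"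
      "\<And>i j. i \<in> S \<Longrightarrow> j \<in> T \<Longrightarrow> \<not> adjacent G (p ! i) (p ! j)" for S T
  proof -
    have inj: "inj_on ((!) p) {..<?n}" using p(1) by (auto simp: inj_on_def nth_eq_iff_index_eq)
    have "\<exists>S T. bipartite_hole G s t S T"
    proof (rule bipartite_hole_shrink[of "(!) p ` S" _ "(!) p ` T"])
      show "(!) p ` S \<inter> (!) p ` T = {}"
        using inj_on_image_Int[OF inj that(1,2)] that(3) by simp
      show "s \<le> card ((!) p ` S)" "t \<le> card ((!) p ` T)"
        using that inj by (auto simp: card_image inj_on_subset)
    qed (use that p(2)[symmetric] in auto)
    then show False using nohole by blast
  qed
  \<comment> \<open>\<open>q\<close> is the index of the \<open>s\<close>-th neighbour of
    \<open>hd p\<close> along the path. It counts both among the \<open>s\<close> indices up to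
    \<open>q\<close> and among the \<open>t\<close> indices from \<open>q\<close> on, so
    \<open>s + t - 1\<close> neighbours are enough.\<close>
  define q where "q = (LEAST q. s \<le> card {i \<in> A. i \<le> q})"
  have "{i \<in> A. i \<le> ?n} = A" by (auto simp: A_def)
  moreover have "s \<le> card A" using cA st by linarith
  ultimately have "s \<le> card {i \<in> A. i \<le> ?n}" by simp
  then have q: "s \<le> card {i \<in> A. i \<le> q}" unfolding q_def by (rule LeastI)
  have "card {i \<in> A. i < q} < s"
  proof (cases q)
    case 0
    then show ?thesis using st by simp
  next
    case (Suc r)
    then have "\<not> s \<le> card {i \<in> A. i \<le> r}" unfolding q_def by (intro not_less_Least) simp
    then show ?thesis using Suc by (simp add: less_Suc_eq_le)
  qed
  moreover have "card {i \<in> A. i < q} + card {i \<in> A. q \<le> i} = card A"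
  proof -
    have "A = {i \<in> A. i < q} \<union> {i \<in> A. q \<le> i}" by auto
    then show ?thesis using fin by (subst card_Un_disjoint[symmetric]) auto
  qed
  ultimately have Ahigh: "t \<le> card {i \<in> A. q \<le> i}" using cA by linarith
  show False
  \<comment> \<open>As \<open>B\<close> has at least \<open>s + t - 1\<close> elements, either
    \<open>t\<close> of them are at least \<open>q\<close> or \<open>s\<close> of them are below
    \<open>q\<close>. The first case pairs indices \<open>i \<le> q \<le> j\<close> and uses
    \<open>parallel\<close>; the second pairs \<open>j < q \<le> i\<close> and uses
    \<open>crossing\<close>. The shifted index sets lie on different sides of a threshold, hence are
    disjoint.\<close>
  proof (cases "t \<le> card {j \<in> B. q \<le> j}")
    case True
    show False
    proof (rule no_index_hole[of "(\<lambda>i. i - 1) ` {i \<in> A. i \<le> q}" "Suc ` {j \<in> B. q \<le> j}"])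
      have "inj_on (\<lambda>i. i - 1) A"
        using Apos by (metis (no_types, lifting) Suc_pred inj_onI diff_Suc_1)
      then show "s \<le> card ((\<lambda>i. i - 1) ` {i \<in> A. i \<le> q})"
        using q by (subst card_image) (auto intro: inj_on_subset)
    qed (use True Apos Bpos parallel in \<open>fastforce simp: card_image\<close>)+
  next
    case False
    have "B = {j \<in> B. j < q} \<union> {j \<in> B. q \<le> j}" by auto
    then have "card {j \<in> B. j < q} + card {j \<in> B. q \<le> j} = card B"
      using fin by (subst card_Un_disjoint[symmetric]) auto
    then have Blow: "s \<le> card {j \<in> B. j < q}" using False cB by linarith
    show False
    proof (rule no_index_hole[of "Suc ` {j \<in> B. j < q}" "Suc ` {i \<in> A. q \<le> i}"])
    qed (use Blow Ahigh Apos Bpos crossing in \<open>auto simp: card_image\<close>)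
  qed
qed

section \<open>Graphs covered by two cliques\<close>

text \<open>Every ordering of a clique is a path, so its ends can be prescribed; they may coincide
  only if the clique is a single vertex.\<close>

lemma ex_list_of_clique:
  assumes "finite L" "x \<in> L" "x' \<in> L" "x \<noteq> x' \<or> L = {x}"
    and clique: "\<And>u v. u \<in> L \<Longrightarrow> v \<in> L \<Longrightarrow> u \<noteq> v \<Longrightarrow> R u v"
  obtains l where "distinct l" "set l = L" "l \<noteq> []" "hd l = x" "last l = x'" "successively R l"
proof -
  obtain m where m: "set m = L - {x, x'}" "distinct m"
    using finite_distinct_list[of "L - {x, x'}"] assms(1) by auto
  define l where "l = (if x = x' then [x] else x # m @ [x'])"
  have l: "distinct l" "set l = L" "l \<noteq> []" "hd l = x" "last l = x'"
    using m assms by (auto simp: l_def)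
  moreover have "successively R l"
    unfolding successively_conv_nth
  proof (intro allI impI)
    fix i assume "Suc i < length l"
    then show "R (l ! i) (l ! Suc i)"
      using l by (intro clique) (auto simp: nth_eq_iff_index_eq)
  qed
  ultimately show thesis using that by blast
qed

text \<open>A path through \<open>L\<close> from \<open>x\<close> to \<open>x'\<close> and a path
  through \<open>H\<close> from \<open>y'\<close> to \<open>y\<close> are closed to a cycle by the
  two linking edges. These edges may share an end only in a one-vertex clique.\<close>

lemma hamiltonian_of_two_cliques:
  assumes "finite (verts G)" "card (verts G) \<ge> 3" "L \<union> H = verts G" "L \<inter> H = {}"
    and cliques: "\<And>u v. u \<in> L \<Longrightarrow> v \<in> L \<Longrightarrow> u \<noteq> v \<Longrightarrow> adjacent G u v"
      "\<And>u v. u \<in> H \<Longrightarrow> v \<in> H \<Longrightarrow> u \<noteq> v \<Longrightarrow> adjacent G u v"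
    and "x \<in> L" "x' \<in> L" "x \<noteq> x' \<or> L = {x}" "y \<in> H" "y' \<in> H" "y \<noteq> y' \<or> H = {y}"
    and "adjacent G x y" "adjacent G x' y'"
  shows "hamiltonian G"
proof -
  have "finite L" "finite H" using assms(1,3) by (auto intro: finite_subset)
  then obtain l h where l: "distinct l" "set l = L" "l \<noteq> []" "hd l = x" "last l = x'"
      "successively (adjacent G) l"
    and h: "distinct h" "set h = H" "h \<noteq> []" "hd h = y'" "last h = y"
      "successively (adjacent G) h"
    using ex_list_of_clique[of L x x' "adjacent G"] ex_list_of_clique[of H y' y "adjacent G"] assms(5-12)
    by (smt (verit))
  have "distinct (l @ h)" "set (l @ h) = verts G" using l h assms by auto
  moreover from this have "length (l @ h) \<ge> 3" using assms(2) by (metis distinct_card)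
  ultimately show ?thesis
    using l h assms by (intro hamiltonianI[of "l @ h"])
      (auto simp: successively_append_iff adjacent_sym)
qed

text \<open>No two edges between \<open>L\<close> and \<open>H\<close> can serve as linking edges,
  so all of them pass through one vertex \<open>c\<close>. Removing \<open>c\<close> from its clique
  leaves two nonempty parts with no edge between them.\<close>

lemma cut_vertex_of_two_cliques:
  assumes fin: "finite (verts G)" and n: "card (verts G) \<ge> 3"
    and LH: "L \<union> H = verts G" "L \<inter> H = {}" "L \<noteq> {}" "H \<noteq> {}"
    and cliques: "\<And>u v. u \<in> L \<Longrightarrow> v \<in> L \<Longrightarrow> u \<noteq> v \<Longrightarrow> adjacent G u v"
      "\<And>u v. u \<in> H \<Longrightarrow> v \<in> H \<Longrightarrow> u \<noteq> v \<Longrightarrow> adjacent G u v"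
    and nham: "\<not> hamiltonian G"
  shows "\<exists>c A B. verts G = insert c (A \<union> B) \<and> c \<notin> A \<and> c \<notin> B \<and> A \<inter> B = {} \<and>
    A \<noteq> {} \<and> B \<noteq> {} \<and> (\<forall>u\<in>A. \<forall>v\<in>B. \<not> adjacent G u v)"
proof -
  have cutL: ?thesis if "c \<in> L" "L \<noteq> {c}" "\<And>u v. u \<in> L \<Longrightarrow> v \<in> H \<Longrightarrow> adjacent G u v \<Longrightarrow> u = c" for c
  proof (intro exI conjI)
    show "verts G = insert c ((L - {c}) \<union> H)" using that(1) LH(1) by blast
  qed (use that LH(2,4) in blast)+
  have cutH: ?thesis if "c \<in> H" "H \<noteq> {c}" "\<And>u v. u \<in> L \<Longrightarrow> v \<in> H \<Longrightarrow> adjacent G u v \<Longrightarrow> v = c" for c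
  proof (intro exI conjI)
    show "verts G = insert c (L \<union> (H - {c}))" using that(1) LH(1) by blast
  qed (use that LH(2,3) in blast)+
  have no_two_edges: False
    if "x \<in> L" "x' \<in> L" "x \<noteq> x' \<or> L = {x}" "y \<in> H" "y' \<in> H" "y \<noteq> y' \<or> H = {y}"
      "adjacent G x y" "adjacent G x' y'" for x x' y y'
    using hamiltonian_of_two_cliques[OF fin n LH(1,2) cliques that] nham by blast
  have not_singletons: "\<not> (L = {x} \<and> H = {y})" for x y
  proof
    assume "L = {x} \<and> H = {y}"
    then have "verts G = {x, y}" using LH(1) by auto
    then show False using n by (simp add: card_insert_if split: if_splits)
  qed
  show ?thesis
  proof (cases "\<exists>x\<in>L. \<exists>y\<in>H. adjacent G x y")
    case False
    \<comment> \<open>Without edges between the cliques, any vertex of a clique with more than one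
      element serves as \<open>c\<close>.\<close>
    obtain x y where xy: "x \<in> L" "y \<in> H" using LH by blast
    then consider "L \<noteq> {x}" | "H \<noteq> {y}" using not_singletons by blast
    then show ?thesis using cutL[of x] cutH[of y] xy False by cases blast+
  next
    case True
    then obtain x y where xy: "x \<in> L" "y \<in> H" "adjacent G x y" by blast
    show ?thesis
    proof (cases "L \<noteq> {x} \<and> (\<forall>u\<in>L. \<forall>v\<in>H. adjacent G u v \<longrightarrow> u = x)")
      case True
      then show ?thesis using cutL[of x] xy by blast
    next
      case noL: False
      have "H \<noteq> {y} \<and> (\<forall>u\<in>L. \<forall>v\<in>H. adjacent G u v \<longrightarrow> v = y)"
      proof (rule ccontr)
        assume noH: "\<not> ?thesis"
        have "\<exists>u\<in>L. \<exists>v\<in>H. adjacent G u v \<and> (u \<noteq> x \<or> L = {x})" using noL xy by blast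
        then obtain x1 y1 where 1: "x1 \<in> L" "y1 \<in> H" "adjacent G x1 y1" "x1 \<noteq> x \<or> L = {x}" by blast
        have "\<exists>u\<in>L. \<exists>v\<in>H. adjacent G u v \<and> (v \<noteq> y \<or> H = {y})" using noH xy by blast
        then obtain x2 y2 where 2: "x2 \<in> L" "y2 \<in> H" "adjacent G x2 y2" "y2 \<noteq> y \<or> H = {y}" by blast
        \<comment> \<open>Comparing with the edge \<open>x y\<close> forces \<open>y1 = y\<close>
          with \<open>H\<close> not a singleton, and \<open>x2 = x\<close> with \<open>L\<close> not
          a singleton. Then \<open>x1 y1\<close> and \<open>x2 y2\<close> are disjoint
          edges.\<close>
        show False
          using no_two_edges[of x x1 y y1] no_two_edges[of x x2 y y2] no_two_edges[of x1 x2 y1 y2] xy 1 2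
          by auto
      qed
      then show ?thesis using cutH[of y] xy by blast
    qed
  qed
qed

section \<open>The edge-maximal supergraph and its cut vertex\<close>

lemma edge_maximal_nonhamiltonian:
  assumes "simple_graph G" "\<not> hamiltonian G"
  obtains E where "edges G \<subseteq> E" "simple_graph (G\<lparr>edges := E\<rparr>)" "\<not> hamiltonian (G\<lparr>edges := E\<rparr>)"
    "\<And>x y. x \<in> verts G \<Longrightarrow> y \<in> verts G \<Longrightarrow> x \<noteq> y \<Longrightarrow> {x, y} \<notin> E \<Longrightarrow>
      hamiltonian (G\<lparr>edges := insert {x, y} E\<rparr>)"
proof -
  let ?\<E> = "{E. simple_graph (G\<lparr>edges := E\<rparr>) \<and> \<not> hamiltonian (G\<lparr>edges := E\<rparr>)}"
  have "?\<E> \<subseteq> Pow (Pow (verts G))" by (auto simp: simple_graph_def)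
  moreover have "finite (verts G)" using assms by (simp add: simple_graph_def)
  ultimately have "finite ?\<E>" by (meson finite_Pow_iff finite_subset)
  moreover have "edges G \<in> ?\<E>" using assms by simp
  ultimately have "\<exists>E\<in>?\<E>. edges G \<subseteq> E \<and> (\<forall>F\<in>?\<E>. E \<subseteq> F \<longrightarrow> E = F)"
    by (rule finite_has_maximal2)
  then obtain E where E: "E \<in> ?\<E>" "edges G \<subseteq> E" "\<forall>F\<in>?\<E>. E \<subseteq> F \<longrightarrow> E = F"
    by (elim bexE conjE)
  show thesis
  proof (rule that[of E])
    fix x y assume xy: "x \<in> verts G" "y \<in> verts G" "x \<noteq> y" "{x, y} \<notin> E"
    then have "simple_graph (G\<lparr>edges := insert {x, y} E\<rparr>)"
      using E(1) by (auto simp: simple_graph_def)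
    then show "hamiltonian (G\<lparr>edges := insert {x, y} E\<rparr>)"
      using bspec[OF E(3), of "insert {x, y} E"] xy(4) by blast
  qed (use E in auto)
qed

lemma degree_mono:
  assumes "finite (verts G)" "edges G \<subseteq> E"
  shows "degree G x \<le> degree (G\<lparr>edges := E\<rparr>) x"
  unfolding degree_def using assms by (intro card_mono) (auto simp: adjacent_def)

text \<open>Passing to the supergraph \<open>M\<close> creates no hole and lowers no degree. A cut
  found in \<open>M\<close> is also a cut in \<open>G\<close>, which has fewer edges. The Ore
  condition is written without subtraction: for \<open>k = s + t - 1\<close> it says that the degree
  sum is at least \<open>2k - 1\<close>.\<close>

lemma cut_vertex_of_ore_no_hole:
  assumes G: "simple_graph G" "card (verts G) \<ge> 3" "\<not> hamiltonian G"
    and st: "s > 0" "t > 0" and nohole: "\<not> (\<exists>S T. bipartite_hole G s t S T)"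
    and ore: "\<And>x y. x \<in> verts G \<Longrightarrow> y \<in> verts G \<Longrightarrow> x \<noteq> y \<Longrightarrow> \<not> adjacent G x y \<Longrightarrow>
      2 * (s + t) \<le> degree G x + degree G y + 3"
  shows "\<exists>c A B. verts G = insert c (A \<union> B) \<and> c \<notin> A \<and> c \<notin> B \<and> A \<inter> B = {} \<and>
    A \<noteq> {} \<and> B \<noteq> {} \<and> (\<forall>u\<in>A. \<forall>v\<in>B. \<not> adjacent G u v)"
proof -
  obtain E where E: "edges G \<subseteq> E" "simple_graph (G\<lparr>edges := E\<rparr>)" "\<not> hamiltonian (G\<lparr>edges := E\<rparr>)"
    and max: "\<And>x y. x \<in> verts G \<Longrightarrow> y \<in> verts G \<Longrightarrow> x \<noteq> y \<Longrightarrow> {x, y} \<notin> E \<Longrightarrow>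
      hamiltonian (G\<lparr>edges := insert {x, y} E\<rparr>)"
    using edge_maximal_nonhamiltonian[OF G(1,3)] by blast
  define M where "M = G\<lparr>edges := E\<rparr>"
  have M: "verts M = verts G" "\<not> hamiltonian M" "finite (verts M)"
    using E by (auto simp: M_def simple_graph_def)
  have adjM: "adjacent M u v" if "adjacent G u v" for u v
    using that E(1) by (auto simp: M_def adjacent_def)
  have irr: "\<not> adjacent M x x" for x
    using E(2) by (auto simp: M_def adjacent_def simple_graph_def)
  have nohole_M: "\<not> (\<exists>S T. bipartite_hole M s t S T)"
    using nohole adjM M(1) unfolding bipartite_hole_def by metis
  have degM: "degree G x \<le> degree M x" for x
    using degree_mono[of G E] E(1) M by (simp add: M_def)
  \<comment> \<open>The threshold is degree \<open>s + t - 1\<close>. Two vertices below it have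
    degree sum at most \<open>2 * (s + t) - 4\<close>, one less than the Ore condition allows for a
    nonadjacent pair.\<close>
  define L where "L = {x \<in> verts M. degree M x + 1 < s + t}"
  define H where "H = {x \<in> verts M. s + t \<le> degree M x + 1}"
  have cliqueL: "adjacent M u v" if "u \<in> L" "v \<in> L" "u \<noteq> v" for u v
  proof (rule ccontr)
    assume "\<not> adjacent M u v"
    then have "2 * (s + t) \<le> degree G u + degree G v + 3"
      using that adjM M(1) by (intro ore) (auto simp: L_def)
    then show False using that degM[of u] degM[of v] by (auto simp: L_def)
  qed
  have cliqueH: "adjacent M u v" if "u \<in> H" "v \<in> H" "u \<noteq> v" for u v
  proof (rule ccontr)
    assume nadj: "\<not> adjacent M u v"
    then have "hamiltonian (M\<lparr>edges := insert {u, v} (edges M)\<rparr>)"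
      using max[of u v] that M(1) by (auto simp: M_def H_def adjacent_def)
    then obtain p where p: "distinct p" "set p = verts M" "successively (adjacent M) p"
      "{hd p, last p} = {u, v}"
      using hamiltonian_path_of_insert_edge[OF _ M(2)] by blast
    have "p \<noteq> []" using p(2) that by (auto simp: H_def)
    moreover have "\<not> adjacent M (hd p) (last p)"
      using p(4) nadj by (simp add: adjacent_def)
    moreover have "hd p \<in> H" "last p \<in> H" using p(4) that by (auto simp: doubleton_eq_iff)
    ultimately have "hamiltonian M"
      using p irr st nohole_M by (intro hamiltonian_of_path_large_end_degrees[of p M s t]) (auto simp: H_def)
    then show False using M(2) by blast
  qed
  have LH: "L \<union> H = verts M" "L \<inter> H = {}" by (auto simp: L_def H_def)
  have card3: "card (verts M) \<ge> 3" using G(2) M(1) by simp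
  \<comment> \<open>If \<open>L\<close> or \<open>H\<close> were empty, the other clique would be
    all of \<open>M\<close>, and a complete graph on at least three vertices is Hamiltonian.\<close>
  have not_complete: False if complete: "\<And>u v. u \<in> verts M \<Longrightarrow> v \<in> verts M \<Longrightarrow> u \<noteq> v \<Longrightarrow> adjacent M u v"
  proof -
    obtain x y where xy: "x \<in> verts M" "y \<in> verts M" "x \<noteq> y"
      using card3 card_le_Suc0_iff_eq[OF M(3)] by fastforce
    obtain l where l: "distinct l" "set l = verts M" "l \<noteq> []" "hd l = x" "last l = y"
        "successively (adjacent M) l"
      by (rule ex_list_of_clique[OF M(3) xy(1,2), of "adjacent M"]) (use xy(3) complete in auto)
    then have "length l \<ge> 3" using card3 by (metis distinct_card)
    then have "hamiltonian M" using l complete[of y x] xy by (intro hamiltonianI[of l]) auto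
    then show False using M(2) by blast
  qed
  have "L \<noteq> {}" using not_complete cliqueH LH by auto
  moreover have "H \<noteq> {}" using not_complete cliqueL LH by auto
  ultimately obtain c A B where "verts M = insert c (A \<union> B)" "c \<notin> A" "c \<notin> B" "A \<inter> B = {}"
    "A \<noteq> {}" "B \<noteq> {}" "\<forall>u\<in>A. \<forall>v\<in>B. \<not> adjacent M u v"
    using cut_vertex_of_two_cliques[OF M(3) card3 LH _ _ cliqueL cliqueH M(2)] by blast
  then show ?thesis using adjM M(1) by metis
qed

section \<open>Size of the smaller part and embedding into a one-sum\<close>

text \<open>A vertex of \<open>A\<close> has its neighbours in \<open>A\<close> and
  \<open>c\<close>, hence degree at most \<open>card A\<close>; likewise for \<open>B\<close>. The
  Ore condition for one vertex of each part then bounds \<open>2 * (s + t)\<close> by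
  \<open>card A + card B + 3\<close>, which is \<open>card (verts G) + 2\<close>.\<close>

lemma cut_part_size_bound:
  assumes G: "simple_graph G"
    and cut: "verts G = insert c (A \<union> B)" "c \<notin> A" "c \<notin> B" "A \<inter> B = {}" "A \<noteq> {}" "B \<noteq> {}"
      "\<And>u v. u \<in> A \<Longrightarrow> v \<in> B \<Longrightarrow> \<not> adjacent G u v"
    and le: "card A \<le> card B"
    and st: "s > 0" "t > 0" and nohole: "\<not> (\<exists>S T. bipartite_hole G s t S T)"
    and ore: "\<And>x y. x \<in> verts G \<Longrightarrow> y \<in> verts G \<Longrightarrow> x \<noteq> y \<Longrightarrow> \<not> adjacent G x y \<Longrightarrow>
      2 * (s + t) \<le> degree G x + degree G y + 3"
  shows "4 * (card A + 1) \<le> card (verts G) + 2"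
proof -
  have fin: "finite A" "finite B" using G cut(1) by (auto simp: simple_graph_def)
  have irr: "\<not> adjacent G x x" for x using G by (auto simp: adjacent_def simple_graph_def)
  have n: "card (verts G) = card A + card B + 1"
    using cut fin by (simp add: card_Un_disjoint)
  have deg: "degree G x \<le> card C"
    if "x \<in> C" "finite C" "c \<notin> C" "{y \<in> verts G. adjacent G x y} \<subseteq> insert c C" for x C
  proof -
    have "{y \<in> verts G. adjacent G x y} \<subseteq> insert c (C - {x})" using that irr by auto
    then have "degree G x \<le> card (insert c (C - {x}))"
      unfolding degree_def using that by (intro card_mono) auto
    also have "\<dots> = card C" using that by (metis card_Suc_Diff1 card_insert_disjoint finite_Diff DiffD1)
    finally show ?thesis .
  qed
  obtain x y where xy: "x \<in> A" "y \<in> B" using cut by blast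
  have "degree G x \<le> card A" using xy cut fin by (intro deg) auto
  moreover have "degree G y \<le> card B" using xy cut fin adjacent_sym[of G y] by (intro deg) auto
  moreover have "2 * (s + t) \<le> degree G x + degree G y + 3" using xy cut by (intro ore) auto
  moreover have sub: "A \<subseteq> verts G" "B \<subseteq> verts G" using cut(1) by auto
  have "card A < s \<or> card B < t"
    using bipartite_hole_shrink[OF sub cut(4) _ _ cut(7), of s t] nohole by (meson not_less)
  moreover have "\<not> adjacent G v u" if "v \<in> B" "u \<in> A" for u v
    using cut(7) that adjacent_sym[of G u v] by blast
  then have "card B < s \<or> card A < t"
    using bipartite_hole_shrink[OF sub(2,1), of s t] cut(4) nohole by (metis not_less inf_commute)
  \<comment> \<open>By the Ore bound and \<open>card A \<le> card B\<close>, both \<open>s\<close>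
    and \<open>t\<close> are at most \<open>card B\<close>. So in either order of the parts it is
    \<open>A\<close> that is too small for a hole: \<open>card A < s\<close> and
    \<open>card A < t\<close>. Hence \<open>2 * (card A + 1) \<le> s + t\<close>, and doubling gives
    the claim.\<close>
  ultimately show ?thesis using le st unfolding n by (elim disjE) simp_all
qed

text \<open>Number \<open>A\<close> first, then \<open>c\<close>, then \<open>B\<close>. As no edge
  joins \<open>A\<close> to \<open>B\<close>, each edge lies in \<open>insert c A\<close> or in
  \<open>insert c B\<close>, and these are mapped onto the two overlapping cliques.\<close>

lemma isomorphic_to_subgraph_one_sum:
  assumes G: "simple_graph G"
    and cut: "verts G = insert c (A \<union> B)" "c \<notin> A" "c \<notin> B" "A \<inter> B = {}"
      "\<And>u v. u \<in> A \<Longrightarrow> v \<in> B \<Longrightarrow> \<not> adjacent G u v"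
  shows "isomorphic_to_subgraph G (complete_one_sum (card A + 1) (card B + 1))"
proof -
  have fin: "finite A" "finite B" using G cut(1) by (auto simp: simple_graph_def)
  let ?a = "card A" and ?b = "card B"
  obtain fA where fA: "bij_betw fA A {0..<?a}" using ex_bij_betw_finite_nat[OF fin(1)] by blast
  obtain fB where fB: "bij_betw fB B {?a + 1..<?a + ?b + 1}"
    using finite_same_card_bij[OF fin(2), of "{?a + 1..<?a + ?b + 1}"] by auto
  define f where "f v = (if v \<in> A then fA v else if v \<in> B then fB v else ?a)" for v
  have fimA: "f ` insert c A = {0..<?a + 1}" and fimB: "f ` insert c B = {?a..<?a + ?b + 1}"
  proof -
    have "f ` A = fA ` A" "f ` B = fB ` B"
      using cut(4) by (intro image_cong; auto simp: f_def)+
    moreover have "f c = ?a" using cut by (simp add: f_def)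
    ultimately show "f ` insert c A = {0..<?a + 1}" "f ` insert c B = {?a..<?a + ?b + 1}"
      using fA fB by (auto simp: bij_betw_def)
  qed
  have inj: "inj_on f (verts G)"
  \<comment> \<open>The image is an interval with as many elements as \<open>verts G\<close>, so
    injectivity follows by counting.\<close>
  proof (rule eq_card_imp_inj_on)
    have "f ` verts G = f ` insert c A \<union> f ` insert c B" using cut(1) by auto
    also have "\<dots> = {0..<?a + ?b + 1}" unfolding fimA fimB by auto
    finally show "card (f ` verts G) = card (verts G)"
      using cut fin by (simp add: card_Un_disjoint)
  qed (use G in \<open>simp add: simple_graph_def\<close>)
  define H where "H = \<lparr>verts = f ` verts G, edges = (`) f ` edges G\<rparr>"
  have edge: "e \<subseteq> verts G" "card e = 2" if "e \<in> edges G" for e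
    using that G by (auto simp: simple_graph_def)
  have card_img: "card (f ` e) = 2" if "e \<in> edges G" for e
    using edge[OF that] inj by (metis card_image inj_on_subset)
  have edge_side: "e \<subseteq> insert c A \<or> e \<subseteq> insert c B" if e: "e \<in> edges G" for e
  proof -
    obtain u v where "e = {u, v}" using edge[OF e] by (auto simp: card_2_iff)
    then show ?thesis
      using edge(1)[OF e] cut(1) cut(5)[of u v] cut(5)[of v u] e
      by (auto simp: adjacent_def insert_commute)
  qed
  have "simple_graph H"
    using G edge card_img by (auto simp: H_def simple_graph_def)
  moreover have "verts H \<subseteq> verts (complete_one_sum (?a + 1) (?b + 1))"
    using fimA fimB cut(1) by (auto simp: H_def complete_one_sum_def complete_graph_def)
  moreover have "edges H \<subseteq> edges (complete_one_sum (?a + 1) (?b + 1))"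
  proof
    fix e' assume "e' \<in> edges H"
    then obtain e where e: "e \<in> edges G" "e' = f ` e" by (auto simp: H_def)
    then have "e' \<subseteq> {0..<?a + 1} \<or> e' \<subseteq> {?a..<?a + ?b + 1}"
      using edge_side[OF e(1)] fimA fimB by (metis image_mono)
    then show "e' \<in> edges (complete_one_sum (?a + 1) (?b + 1))"
      using card_img[OF e(1)] e(2) by (auto simp: complete_one_sum_def complete_graph_def)
  qed
  ultimately have "subgraph H (complete_one_sum (?a + 1) (?b + 1))"
    by (simp add: subgraph_def)
  moreover have "isomorphic G H"
    unfolding isomorphic_def
  proof (intro exI[of _ f] conjI ballI)
    show "bij_betw f (verts G) (verts H)" using inj by (simp add: H_def bij_betw_def)
  next
    fix x y assume xy: "x \<in> verts G" "y \<in> verts G"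
    have "adjacent H (f x) (f y) \<longleftrightarrow> f ` {x, y} \<in> (`) f ` edges G"
      by (simp add: H_def adjacent_def)
    also have "\<dots> \<longleftrightarrow> {x, y} \<in> edges G"
    proof
      assume "f ` {x, y} \<in> (`) f ` edges G"
      then obtain e where "e \<in> edges G" "f ` {x, y} = f ` e" by blast
      then show "{x, y} \<in> edges G"
        using inj_on_image_eq_iff[OF inj, of "{x, y}" e] edge xy by auto
    qed blast
    finally show "adjacent G x y \<longleftrightarrow> adjacent H (f x) (f y)" by (simp add: adjacent_def)
  qed
  ultimately show ?thesis unfolding isomorphic_to_subgraph_def by blast
qed

section \<open>The bipartite-hole-number and the conclusion\<close>

lemma bipartite_hole_number_attained:
  assumes "finite (verts G)"
  obtains s t where "s > 0" "t > 0" "s + t = bipartite_hole_number G + 1"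
    "\<not> (\<exists>S T. bipartite_hole G s t S T)"
proof -
  let ?P = "\<lambda>k. \<exists>s t. s > 0 \<and> t > 0 \<and> s + t = k + 1 \<and> \<not> (\<exists>S T. bipartite_hole G s t S T)"
  \<comment> \<open>A side larger than the vertex set cannot exist, so the set whose least element
    is taken is nonempty.\<close>
  have "\<not> bipartite_hole G (card (verts G) + 1) 1 S T" for S T
    using card_mono[OF assms, of S] by (auto simp: bipartite_hole_def)
  then have "?P (card (verts G) + 1)"
    by (intro exI[of _ "card (verts G) + 1"] exI[of _ 1]) auto
  then have "?P (bipartite_hole_number G)"
    unfolding bipartite_hole_number_def by (rule LeastI[of ?P])
  then show thesis using that by blast
qed

lemma sigma2_le:
  assumes "x \<in> verts G" "y \<in> verts G" "x \<noteq> y" "\<not> adjacent G x y"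
  shows "sigma2 G \<le> enat (degree G x + degree G y)"
  unfolding sigma2_def using assms by (intro Inf_lower) auto

lemma hamiltonian_or_one_sum:
  assumes G: "simple_graph G" "card (verts G) = n" "n \<ge> 3"
    and sigma: "sigma2 G \<ge> enat (2 * bipartite_hole_number G - 1)"
  shows "hamiltonian G \<or> (\<exists>k\<ge>2. 4 * k \<le> n + 2 \<and>
    isomorphic_to_subgraph G (complete_one_sum k (n + 1 - k)))"
proof (cases "hamiltonian G")
  case nham: False
  have fin: "finite (verts G)" using G by (simp add: simple_graph_def)
  obtain s t where st: "s > 0" "t > 0" "s + t = bipartite_hole_number G + 1"
    and nohole: "\<not> (\<exists>S T. bipartite_hole G s t S T)"
    using bipartite_hole_number_attained[OF fin] by blast
  \<comment> \<open>Here \<open>s + t\<close> exceeds the bipartite-hole-number by one, and that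
    number is positive, so the subtraction in the hypothesis on \<open>sigma2\<close> does not
    truncate.\<close>
  have ore: "2 * (s + t) \<le> degree G x + degree G y + 3"
    if "x \<in> verts G" "y \<in> verts G" "x \<noteq> y" "\<not> adjacent G x y" for x y
    using order_trans[OF sigma sigma2_le[OF that]] st by simp
  have fits: "\<exists>k\<ge>2. 4 * k \<le> n + 2 \<and> isomorphic_to_subgraph G (complete_one_sum k (n + 1 - k))"
    if cut: "verts G = insert c (A \<union> B)" "c \<notin> A" "c \<notin> B" "A \<inter> B = {}" "A \<noteq> {}" "B \<noteq> {}"
      "\<And>u v. u \<in> A \<Longrightarrow> v \<in> B \<Longrightarrow> \<not> adjacent G u v" and le: "card A \<le> card B" for c A B
  \<comment> \<open>The cut vertex is counted in both cliques: \<open>k = card A + 1\<close> and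
    \<open>n + 1 - k = card B + 1\<close>. Nonemptiness of \<open>A\<close> gives
    \<open>k \<ge> 2\<close>.\<close>
  proof (intro exI[of _ "card A + 1"] conjI)
    have finAB: "finite A" "finite B" using fin cut(1) by auto
    then have "n = card A + card B + 1" using cut G(2) by (simp add: card_Un_disjoint)
    then show "isomorphic_to_subgraph G (complete_one_sum (card A + 1) (n + 1 - (card A + 1)))"
      using isomorphic_to_subgraph_one_sum[OF G(1) cut(1-4,7)] by simp
    show "4 * (card A + 1) \<le> n + 2"
      using cut_part_size_bound[OF G(1) cut le st(1,2) nohole ore] G(2) by simp
    show "2 \<le> card A + 1" using finAB cut(5) by (simp add: Suc_le_eq card_gt_0_iff)
  qed
  have "card (verts G) \<ge> 3" using G by simp
  from cut_vertex_of_ore_no_hole[OF G(1) this nham st(1,2) nohole ore]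
  obtain c A B where cut: "verts G = insert c (A \<union> B)" "c \<notin> A" "c \<notin> B" "A \<inter> B = {}"
    "A \<noteq> {}" "B \<noteq> {}" "\<forall>u\<in>A. \<forall>v\<in>B. \<not> adjacent G u v"
    by blast
  show ?thesis
  proof (cases "card A \<le> card B")
    case True
    then show ?thesis using fits[of c A B] cut by blast
  next
    case False
    have "\<not> adjacent G v u" if "v \<in> B" "u \<in> A" for u v
      using cut(7) that adjacent_sym[of G u v] by blast
    then show ?thesis
      using fits[of c B A] False cut(1-6) by (simp add: Un_commute Int_commute)
  qed
qed simp

theorem theorem1p3:
  fixes G :: "'a graph" and n :: nat
  assumes "simple_graph G"
    and "card (verts G) = n"
    and "n \<ge> 2"
    and "sigma2 G \<ge> enat (2 * bipartite_hole_number G - 1)"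
  shows "(hamiltonian G \<or>
      (\<exists>k::nat. k > 0 \<and> real k \<le> (real n + 2) / 4 \<and>
         isomorphic_to_subgraph G (complete_one_sum k (n + 1 - k)))) \<and>
    (n \<ge> 3 \<longrightarrow> hamiltonian G \<or>
      (\<exists>k::nat. k \<ge> 2 \<and> real k \<le> (real n + 2) / 4 \<and>
         isomorphic_to_subgraph G (complete_one_sum k (n + 1 - k))))"
proof (intro conjI impI)
  have fin: "finite (verts G)" using assms(1) by (simp add: simple_graph_def)
  obtain c where c: "c \<in> verts G" using assms(2,3) by fastforce
  \<comment> \<open>For \<open>k = 1\<close> the one-sum is the complete graph on \<open>n\<close>
    vertices, obtained with an empty part and an arbitrary vertex \<open>c\<close>. The bound
    \<open>1 \<le> (n + 2) / 4\<close> comes from \<open>n \<ge> 2\<close>.\<close>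
  have "isomorphic_to_subgraph G (complete_one_sum (card ({}::'a set) + 1) (card (verts G - {c}) + 1))"
    using c by (intro isomorphic_to_subgraph_one_sum[OF assms(1), of c]) auto
  then have "isomorphic_to_subgraph G (complete_one_sum 1 (n + 1 - 1))"
    using c fin assms(2,3) by simp
  then show "hamiltonian G \<or>
      (\<exists>k::nat. k > 0 \<and> real k \<le> (real n + 2) / 4 \<and>
         isomorphic_to_subgraph G (complete_one_sum k (n + 1 - k)))"
    using assms(3) by (intro disjI2 exI[of _ 1]) auto
next
  assume "n \<ge> 3"
  have real_bound: "real k \<le> (real n + 2) / 4" if "4 * k \<le> n + 2" for k
    using of_nat_mono[OF that, where 'a = real] by simp
  show "hamiltonian G \<or>
      (\<exists>k::nat. k \<ge> 2 \<and> real k \<le> (real n + 2) / 4 \<and>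
         isomorphic_to_subgraph G (complete_one_sum k (n + 1 - k)))"
    using hamiltonian_or_one_sum[OF assms(1,2) \<open>n \<ge> 3\<close> assms(4)] real_bound by blast
qed

end
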